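(* The $\boldsymbol{s}$-lecture hall polytope $\mathbf{P}_2^{(s_1,s_2)}$ is level for any $\boldsymbol{s}=(s_1,s_2)\in\mathbb{Z}_{\ge1}^2$.
   Context: For $\boldsymbol{s}=(s_1,\ldots,s_n)\in\mathbb{Z}_{\ge1}^n$, the $\boldsymbol{s}$-lecture hall polytope is $$\mathbf{P}_n^{(\boldsymbol{s})}=\left\{\boldsymbol{\lambda}\in\mathbb{R}^n : 0\leq\frac{\lambda_1}{s_1}\leq\cdots\leq\frac{\lambda_n}{s_n}\leq 1\right\},$$ a lattice simplex. Levelness: for a lattice polytope $P\subset\mathbb{R}^n$ with vertex set $V(P)$, $\mathrm{cone}(P)=\mathrm{span}_{\mathbb{R}_{\ge0}}\{(\boldsymbol{v},1):\boldsymbol{v}\in V(P)\}\subset\mathbb{R}^{n+1}$, with relative interior $\mathrm{cone}(P)^\circ$. $P$ is level if the semigroup algebra $k[P]=k[\mathrm{cone}(P)\cap\mathbb{Z}^{n+1}]$ ($k$ an algebraically closed field of characteristic zero, graded by the last coordinate) is level, i.e. its canonical module $k[\mathrm{cone}(P)^\circ\cap\mathbb{Z}^{n+1}]$ is generated by elements of the same degree; equivalently, there are finitely many $\boldsymbol{c}_1,\ldots,\boldsymbol{c}_m\in\mathbb{Z}^{n+1}$, all with the same last coordinate, such that $\bigcup_{i=1}^m\bigl(\boldsymbol{c}_i+(\mathrm{cone}(P)\cap\mathbb{Z}^{n+1})\bigr)=\mathrm{cone}(P)^\circ\cap\mathbb{Z}^{n+1}$. *)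

theory Defs
  imports
    "HOL-Analysis.Analysis"
    "HOL-Library.Poly_Mapping"
    "HOL-Computational_Algebra.Polynomial"
begin

text \<open>The coordinates are indexed by a finite linear order, so that the chain of inequalities
  \<open>0 \<le> x\<^sub>1 / s\<^sub>1 \<le> \<dots> \<le> x\<^sub>n / s\<^sub>n \<le> 1\<close> becomes monotonicity in the index. For the
  numeral type \<open>2\<close> the indices in increasing order are \<open>0\<close> and \<open>1\<close> (where \<open>0 = 2\<close>).\<close>

definition lecture_hall_polytope :: "int ^ 'n::{finite,linorder} \<Rightarrow> (real ^ 'n::{finite,linorder}) set" where
  "lecture_hall_polytope s =
    {x. (\<forall>i. 0 \<le> x $ i / of_int (s $ i)) \<and>
        (\<forall>i j. i \<le> j \<longrightarrow> x $ i / of_int (s $ i) \<le> x $ j / of_int (s $ j)) \<and>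
        (\<forall>i. x $ i / of_int (s $ i) \<le> 1)}"

text \<open>The spaces \<open>\<real>\<^bsup>n+1\<^esup>\<close> and \<open>\<int>\<^bsup>n+1\<^esup>\<close> are rendered as products; the second component is the
  last coordinate.\<close>

type_synonym 'n lattice = "(int ^ 'n) \<times> int"

definition polytope_cone :: "(real ^ 'n) set \<Rightarrow> ((real ^ 'n) \<times> real) set" where
  "polytope_cone P = convex_cone hull ((\<lambda>v. (v, 1)) ` {v. v extreme_point_of P})"

definition lattice_embed :: "'n lattice \<Rightarrow> (real ^ 'n) \<times> real" where
  "lattice_embed z = (\<chi> i. of_int (fst z $ i), of_int (snd z))"

definition lattice_points :: "((real ^ 'n) \<times> real) set \<Rightarrow> 'n lattice set" where
  "lattice_points C = {z. lattice_embed z \<in> C}"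

text \<open>The type \<open>'n lattice \<Rightarrow>\<^sub>0 'k\<close> with its convolution product is the group algebra
  \<open>k[\<int>\<^bsup>n+1\<^esup>]\<close>. All the algebras and modules below are \<open>k\<close>-subspaces of it spanned by monomials.\<close>

definition monomial_span :: "'n lattice set \<Rightarrow> ('n lattice \<Rightarrow>\<^sub>0 'k::zero) set" where
  "monomial_span S = {f. Poly_Mapping.keys f \<subseteq> S}"

definition polytope_algebra ::
    "(real ^ 'n) set \<Rightarrow> ('n lattice \<Rightarrow>\<^sub>0 'k::field) set" where
  "polytope_algebra P = monomial_span (lattice_points (polytope_cone P))"

definition canonical_module ::
    "(real ^ 'n) set \<Rightarrow> ('n lattice \<Rightarrow>\<^sub>0 'k::field) set" where
  "canonical_module P = monomial_span (lattice_points (rel_interior (polytope_cone P)))"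

definition homogeneous_of_degree ::
    "int \<Rightarrow> ('n lattice \<Rightarrow>\<^sub>0 'k::zero) \<Rightarrow> bool" where
  "homogeneous_of_degree d f \<longleftrightarrow> (\<forall>z \<in> Poly_Mapping.keys f. snd z = d)"

definition submodule_generated :: "'a::comm_ring_1 set \<Rightarrow> 'a set \<Rightarrow> 'a set" where
  "submodule_generated R G =
    {(\<Sum>g\<in>F. a g * g) | a F. finite F \<and> F \<subseteq> G \<and> (\<forall>g\<in>F. a g \<in> R)}"

text \<open>The first argument only fixes the coefficient field.\<close>

definition level_polytope ::
    "'k::{alg_closed_field, field_char_0} itself \<Rightarrow> (real ^ 'n) set \<Rightarrow> bool" where
  "level_polytope (_ :: 'k itself) P \<longleftrightarrow>
    (\<exists>d. \<exists>G :: ('n lattice \<Rightarrow>\<^sub>0 'k) set.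
       finite G \<and> G \<subseteq> canonical_module P \<and> (\<forall>g\<in>G. homogeneous_of_degree d g) \<and>
       submodule_generated (polytope_algebra P) G = canonical_module P)"

text \<open>Levelness in terms of lattice points only. In particular it does not depend on the
  coefficient field.\<close>

lemma zero_in_lattice_points_cone:
  fixes P :: "(real ^ 'n) set"
  shows "0 \<in> lattice_points (polytope_cone P)"
proof -
  have "lattice_embed (0 :: 'n lattice) = 0"
    by (simp add: lattice_embed_def zero_prod_def vec_eq_iff)
  then show ?thesis
    by (simp add: lattice_points_def polytope_cone_def convex_cone_contains_0
        convex_cone_convex_cone_hull)
qed

lemma sum_monomials:
  "(\<Sum>x\<in>Poly_Mapping.keys f. Poly_Mapping.single x (Poly_Mapping.lookup f x)) = f"
  by (rule poly_mapping_eqI)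
    (auto simp: lookup_sum lookup_single when_def in_keys_iff)

lemma keys_mult_single_left:
  fixes f :: "'a::ab_group_add \<Rightarrow>\<^sub>0 'k::semiring_0"
  shows "Poly_Mapping.keys (Poly_Mapping.single c b * f) \<subseteq> (\<lambda>a. c + a) ` Poly_Mapping.keys f"
  using keys_mult[of "Poly_Mapping.single c b" f] by (auto split: if_splits)

lemma keys_mult_single_right:
  fixes f :: "'a::ab_group_add \<Rightarrow>\<^sub>0 'k::semiring_0"
  shows "Poly_Mapping.keys (f * Poly_Mapping.single c b) \<subseteq> (\<lambda>a. a + c) ` Poly_Mapping.keys f"
  using keys_mult[of f "Poly_Mapping.single c b"] by (auto split: if_splits)

lemma level_polytope_iff:
  fixes P :: "(real ^ 'n) set"
  defines "S \<equiv> lattice_points (polytope_cone P)"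
  defines "I \<equiv> lattice_points (rel_interior (polytope_cone P))"
  shows "level_polytope TYPE('k::{alg_closed_field, field_char_0}) P \<longleftrightarrow>
    (\<exists>d C. finite C \<and> (\<forall>c\<in>C. snd c = d) \<and> (\<Union>c\<in>C. (\<lambda>z. c + z) ` S) = I)"
proof
  assume "level_polytope TYPE('k) P"
  then obtain d and G :: "('n lattice \<Rightarrow>\<^sub>0 'k) set"
    where G: "finite G" "G \<subseteq> monomial_span I" "\<forall>g\<in>G. homogeneous_of_degree d g"
      and gen: "submodule_generated (monomial_span S) G = monomial_span I"
    unfolding level_polytope_def canonical_module_def polytope_algebra_def S_def I_def by blast
  define C where "C = (\<Union>g\<in>G. Poly_Mapping.keys g)"
  have "c + z \<in> I" if "c \<in> C" "z \<in> S" for c z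
  proof -
    obtain g where g: "g \<in> G" "c \<in> Poly_Mapping.keys g"
      using \<open>c \<in> C\<close> unfolding C_def by blast
    have "Poly_Mapping.single z 1 \<in> (monomial_span S :: (_ \<Rightarrow>\<^sub>0 'k) set)"
      using \<open>z \<in> S\<close> by (simp add: monomial_span_def)
    then have "Poly_Mapping.single z 1 * g \<in> submodule_generated (monomial_span S) G"
      unfolding submodule_generated_def using g
      by (auto intro!: exI[of _ "\<lambda>_. Poly_Mapping.single z 1"] exI[of _ "{g}"])
    then have sub: "Poly_Mapping.keys (Poly_Mapping.single z 1 * g) \<subseteq> I"
      using gen by (simp add: monomial_span_def)
    have "g = Poly_Mapping.single (- z) 1 * (Poly_Mapping.single z 1 * g)"
      by (simp add: mult.assoc[symmetric] mult_single)
    then have "c \<in> Poly_Mapping.keys (Poly_Mapping.single (- z) 1 * (Poly_Mapping.single z 1 * g))"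
      using g by metis
    then obtain x where "x \<in> Poly_Mapping.keys (Poly_Mapping.single z 1 * g)" "c = - z + x"
      using keys_mult_single_left[of "- z" 1 "Poly_Mapping.single z 1 * g"] by blast
    then show ?thesis
      using sub by auto
  qed
  moreover have "\<exists>c\<in>C. \<exists>z\<in>S. x = c + z" if "x \<in> I" for x
  proof -
    have "Poly_Mapping.single x (1::'k) \<in> submodule_generated (monomial_span S) G"
      using that gen by (simp add: monomial_span_def)
    then obtain a F where F: "finite F" "F \<subseteq> G" "\<forall>g\<in>F. a g \<in> monomial_span S"
      and eq: "Poly_Mapping.single x (1::'k) = (\<Sum>g\<in>F. a g * g)"
      unfolding submodule_generated_def by blast
    have "x \<in> Poly_Mapping.keys (Poly_Mapping.single x (1::'k))"
      by simp
    then have "x \<in> (\<Union>g\<in>F. Poly_Mapping.keys (a g * g))"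
      using keys_sum[of "\<lambda>g. a g * g" F] unfolding eq by (rule rev_subsetD)
    then obtain g where g: "g \<in> F" "x \<in> Poly_Mapping.keys (a g * g)"
      by blast
    then obtain z c where "x = z + c" "z \<in> Poly_Mapping.keys (a g)" "c \<in> Poly_Mapping.keys g"
      using keys_mult[of "a g" g] by blast
    moreover have "c \<in> C" "z \<in> S"
      using F g calculation by (auto simp: C_def monomial_span_def)
    ultimately show ?thesis
      using add.commute by blast
  qed
  ultimately have "(\<Union>c\<in>C. (\<lambda>z. c + z) ` S) = I"
    by blast
  moreover have "finite C" "\<forall>c\<in>C. snd c = d"
    using G by (auto simp: C_def homogeneous_of_degree_def)
  ultimately show "\<exists>d C. finite C \<and> (\<forall>c\<in>C. snd c = d) \<and> (\<Union>c\<in>C. (\<lambda>z. c + z) ` S) = I"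
    by blast
next
  assume "\<exists>d C. finite C \<and> (\<forall>c\<in>C. snd c = d) \<and> (\<Union>c\<in>C. (\<lambda>z. c + z) ` S) = I"
  then obtain d C where C: "finite C" "\<forall>c\<in>C. snd c = d" "(\<Union>c\<in>C. (\<lambda>z. c + z) ` S) = I"
    by blast
  have "C \<subseteq> I"
    using C(3) zero_in_lattice_points_cone[of P] unfolding S_def by force
  define m :: "_ \<Rightarrow> 'n lattice \<Rightarrow>\<^sub>0 'k" where "m = (\<lambda>c. Poly_Mapping.single c 1)"
  have "inj m"
    by (rule injI) (metis m_def keys_single one_neq_zero singleton_inject)
  define M where "M = submodule_generated (monomial_span S) (m ` C)"
  have M_sum: "(\<Sum>c\<in>C. b c * m c) \<in> M" if "\<forall>c\<in>C. b c \<in> monomial_span S" for b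
  proof -
    have "(\<Sum>c\<in>C. b c * m c) = (\<Sum>g\<in>m ` C. b (the_inv m g) * g)"
      using \<open>inj m\<close> by (subst sum.reindex) (auto simp: the_inv_f_f intro: inj_on_subset)
    then show ?thesis
      using that \<open>inj m\<close> C(1) unfolding M_def submodule_generated_def
      by (auto simp: the_inv_f_f intro!: exI[of _ "\<lambda>g. b (the_inv m g)"] exI[of _ "m ` C"])
  qed
  have "M \<subseteq> monomial_span I"
  proof
    fix f assume "f \<in> M"
    then obtain a F where F: "finite F" "F \<subseteq> m ` C" "\<forall>g\<in>F. a g \<in> monomial_span S"
      and f: "f = (\<Sum>g\<in>F. a g * g)"
      unfolding M_def submodule_generated_def by blast
    have "Poly_Mapping.keys (a g * g) \<subseteq> I" if gF: "g \<in> F" for g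
    proof -
      obtain c where c: "c \<in> C" "g = m c"
        using gF F by blast
      have "Poly_Mapping.keys (a g * g) \<subseteq> (\<lambda>z. z + c) ` S"
        using keys_mult_single_right[of "a g" c 1] F gF c
        unfolding monomial_span_def m_def by blast
      then show ?thesis
        using C(3) c(1) unfolding add.commute[of _ c] by blast
    qed
    then show "f \<in> monomial_span I"
      unfolding f monomial_span_def using keys_sum[of "\<lambda>g. a g * g" F] by blast
  qed
  moreover have "f \<in> M" if "f \<in> monomial_span I" for f
  proof -
    have "\<exists>c\<in>C. \<exists>z\<in>S. x = c + z" if "x \<in> I" for x
      using C(3) that by blast
    then obtain h where h: "\<And>x. x \<in> I \<Longrightarrow> h x \<in> C \<and> x - h x \<in> S"
      by (metis add_diff_cancel_left')
    have keys: "Poly_Mapping.keys f \<subseteq> I"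
      using \<open>f \<in> monomial_span I\<close> by (simp add: monomial_span_def)
    define b where "b c = (\<Sum>x\<in>{x \<in> Poly_Mapping.keys f. h x = c}.
      Poly_Mapping.single (x - c) (Poly_Mapping.lookup f x))" for c
    have "b c \<in> monomial_span S" for c
    proof -
      have "Poly_Mapping.keys (b c) \<subseteq> (\<Union>x\<in>{x \<in> Poly_Mapping.keys f. h x = c}.
          Poly_Mapping.keys (Poly_Mapping.single (x - c) (Poly_Mapping.lookup f x)))"
        unfolding b_def by (rule keys_sum)
      also have "\<dots> \<subseteq> S"
        using h keys by (auto split: if_splits)
      finally show ?thesis
        by (simp add: monomial_span_def)
    qed
    then have "(\<Sum>c\<in>C. b c * m c) \<in> M"
      by (intro M_sum) blast
    also have "(\<Sum>c\<in>C. b c * m c) = (\<Sum>c\<in>C. \<Sum>x\<in>{x \<in> Poly_Mapping.keys f. h x = c}.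
        Poly_Mapping.single x (Poly_Mapping.lookup f x))"
      by (simp add: b_def m_def sum_distrib_right mult_single)
    also have "\<dots> = (\<Sum>x\<in>Poly_Mapping.keys f. Poly_Mapping.single x (Poly_Mapping.lookup f x))"
      using C(1) h keys by (intro sum.group) auto
    also have "\<dots> = f"
      by (rule sum_monomials)
    finally show ?thesis .
  qed
  ultimately have "submodule_generated (monomial_span S) (m ` C) = monomial_span I"
    unfolding M_def by blast
  moreover have "m ` C \<subseteq> monomial_span I" "\<forall>g\<in>m ` C. homogeneous_of_degree d g"
    using \<open>C \<subseteq> I\<close> C(2) by (auto simp: m_def monomial_span_def homogeneous_of_degree_def)
  ultimately show "level_polytope TYPE('k) P"
    unfolding level_polytope_def canonical_module_def polytope_algebra_def
    using C(1) unfolding S_def I_def by blast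
qed

end

theory Submission
  imports Defs
begin

text \<open>Write \<open>a = s\<^sub>1\<close> and \<open>b = s\<^sub>2\<close>. The cone over the polytope is \<open>0 \<le> x\<close>, \<open>b x \<le> a y\<close>, \<open>y \<le> b t\<close>,
  and its interior is given by the strict inequalities. Every interior lattice point is an
  interior lattice point of the minimal height \<open>d\<close> plus a lattice point of the cone: subtracting
  vertices of the triangle one may assume that all barycentric coordinates are at most one, so that
  the height \<open>t\<close>, which is their sum, is at most \<open>3\<close>, with equality only for the sum of the three
  vertices. There \<open>d = 1\<close> if \<open>a + b < a b\<close>, \<open>d = 3\<close> if \<open>a = b = 1\<close>, and \<open>d = 2\<close> otherwise; the one
  laborious case is \<open>d = 1\<close>, \<open>t = 2\<close>.\<close>

section \<open>Inequalities of the cone and of its interior\<close>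

text \<open>Polymorphic and free of division, so that one predicate serves both the real cone and
  its lattice points.\<close>

definition in_cone :: "'a::linordered_idom \<Rightarrow> 'a \<Rightarrow> 'a \<Rightarrow> 'a \<Rightarrow> 'a \<Rightarrow> bool" where
  "in_cone a b x y t \<longleftrightarrow> 0 \<le> x \<and> b * x \<le> a * y \<and> y \<le> b * t"

definition in_interior :: "'a::linordered_idom \<Rightarrow> 'a \<Rightarrow> 'a \<Rightarrow> 'a \<Rightarrow> 'a \<Rightarrow> bool" where
  "in_interior a b x y t \<longleftrightarrow> 0 < x \<and> b * x < a * y \<and> y < b * t"

lemma in_cone_add:
  "in_cone a b x y t \<Longrightarrow> in_cone a b x' y' t' \<Longrightarrow> in_cone a b (x + x') (y + y') (t + t')"
  by (auto simp: in_cone_def distrib_left intro: add_mono)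

lemma in_interior_add:
  "in_interior a b x y t \<Longrightarrow> in_cone a b x' y' t' \<Longrightarrow> in_interior a b (x + x') (y + y') (t + t')"
  by (auto simp: in_cone_def in_interior_def distrib_left intro: add_less_le_mono add_pos_nonneg)

text \<open>Everything follows from the chain
  \<open>0 \<le> b * x \<le> a * y \<le> a * (b * t)\<close>. The bounds make every slice of fixed
  height bounded.\<close>

lemma in_cone_bounds:
  assumes "0 < a" "0 < b" "in_cone a b x y t"
  shows "0 \<le> x" "0 \<le> y" "0 \<le> t" "x \<le> a * t" "y \<le> b * t"
proof -
  have c: "0 \<le> x" "b * x \<le> a * y" "y \<le> b * t"
    using assms by (auto simp: in_cone_def)
  have "0 \<le> b * x"
    using c assms by simp
  then have "0 \<le> a * y"
    using c(2) by (rule order_trans)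
  then show "0 \<le> y"
    using assms by (simp add: zero_le_mult_iff)
  then have "0 \<le> b * t"
    using c by simp
  then show "0 \<le> t"
    using assms by (simp add: zero_le_mult_iff)
  have "a * y \<le> a * (b * t)"
    using c assms by simp
  then have "b * x \<le> b * (a * t)"
    using c by (simp add: mult.left_commute)
  then show "x \<le> a * t"
    using assms by simp
qed (use assms in \<open>auto simp: in_cone_def\<close>)

lemma in_interior_imp_in_cone: "in_interior a b x y t \<Longrightarrow> in_cone a b x y t"
  by (simp add: in_interior_def in_cone_def)

section \<open>Splitting interior lattice points of height two and three\<close>

text \<open>The condition \<open>a + b < a * b\<close> says that \<open>(1, b - 1)\<close> is an interior point of the polytope,
  and \<open>b \<le> y\<close> that the barycentric coordinate of \<open>(0, 0)\<close> is at most one.\<close>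

lemma split_degree_two:
  fixes a b x y :: int
  assumes pos: "1 \<le> a" "1 \<le> b" and big: "a + b < a * b"
    and int: "in_interior a b x y 2" and bary: "x \<le> a" "b \<le> y"
  shows "\<exists>p q. in_interior a b p q 1 \<and> in_cone a b (x - p) (y - q) 1"
proof -
  have I: "0 < x" "b * x < a * y" "y < b * 2"
    using int by (auto simp: in_interior_def)
  consider "b < a * (y - b)" | "a * (y - b) \<le> b" "x = a" | "a * (y - b) \<le> b" "x \<le> a - 1"
    using \<open>x \<le> a\<close> by linarith
  then show ?thesis
  proof cases
    case 1
    have "b * (x - 1) \<le> a * b"
      using mult_left_mono[of "x - 1" a b] pos bary by (simp add: mult.commute)
    \<comment> \<open>The remainder \<open>(x - 1, b)\<close> has height one and lies on the facet
      \<open>y = b * t\<close>.\<close>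
    then show ?thesis
      using 1 I by (intro exI[of _ 1] exI[of _ "y - b"]) (auto simp: in_interior_def in_cone_def)
  next
    case 2
    define w where "w = y - b"
    have y: "y = b + w"
      by (simp add: w_def)
    have "0 < a * w"
      using I 2 by (simp add: y algebra_simps)
    then have w: "1 \<le> w"
      using pos by (simp add: zero_less_mult_iff)
    have aw: "a * w \<le> b"
      using 2 by (simp add: w_def)
    \<comment> \<open>The least \<open>q\<close> for which \<open>(1, q)\<close> lies strictly above
      the line \<open>b * x = a * y\<close>; it stays below \<open>b\<close> by
      \<open>big\<close>.\<close>
    define q where "q = b div a + 1"
    have "a * (b div a) + b mod a = b" "0 \<le> b mod a" "b mod a < a"
      using pos by simp_all
    moreover have "a * q = a * (b div a) + a"
      by (simp add: q_def distrib_left)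
    ultimately have q: "b < a * q" "a * q \<le> a + b"
      by linarith+
    have "a * q < a * b"
      using q(2) big by linarith
    then have "q < b"
      using pos by simp
    have "a * w < a * q"
      using aw q by linarith
    then have "w < q"
      using pos by simp
    have "a \<le> a * w"
      using mult_left_mono[OF w, of a] pos by simp
    moreover have "b * (a - 1) = a * b - b" "a * (y - q) = a * b + a * w - a * q"
      by (simp_all add: y algebra_simps)
    ultimately have "b * (a - 1) \<le> a * (y - q)"
      using q by linarith
    then show ?thesis
      using 2 q \<open>q < b\<close> \<open>w < q\<close> pos
      by (intro exI[of _ 1] exI[of _ q]) (auto simp: in_interior_def in_cone_def y)
  next
    case 3
    \<comment> \<open>With second coordinate \<open>b - 1\<close> split off, the remainder has
      second coordinate at least \<open>1\<close>, so its first coordinate may be as large as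
      \<open>a div b\<close>. The least positive \<open>p\<close> achieving this leaves the most
      room for \<open>b * p < a * (b - 1)\<close>.\<close>
    define p where "p = max 1 (x - a div b)"
    have "b * (a div b) + a mod b = a" "0 \<le> a mod b" "a mod b < b" "0 \<le> a div b"
      using pos by (simp_all add: pos_imp_zdiv_nonneg_iff)
    then have D: "b * (a div b) \<le> a" "a < b * (a div b) + b" "0 \<le> a div b"
      by linarith+
    have p: "1 \<le> p" "p \<le> x"
      using I D by (auto simp: p_def)
    have "x - p \<le> a div b"
      by (simp add: p_def)
    then have "b * (x - p) \<le> a"
      using mult_left_mono[of "x - p" "a div b" b] D pos by linarith
    moreover have "a \<le> a * (y - (b - 1))"
      using mult_left_mono[of 1 "y - (b - 1)" a] pos bary by simp
    moreover have "b * p < a * (b - 1)"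
    proof (cases "p = 1")
      case False
      then have "b * p = b * x - b * (a div b)"
        by (auto simp: p_def max_def right_diff_distrib split: if_splits)
      moreover have "b * x \<le> b * (a - 1)"
        using mult_left_mono[OF 3(2), of b] pos by simp
      ultimately show ?thesis
        using D unfolding right_diff_distrib mult.commute[of b a] by linarith
    qed (use big in \<open>simp add: algebra_simps\<close>)
    ultimately show ?thesis
      using p I by (intro exI[of _ p] exI[of _ "b - 1"]) (auto simp: in_interior_def in_cone_def)
  qed
qed

text \<open>Treats the sum \<open>(a, 2 * b, 3)\<close> of the three vertices. The remainder after
  \<open>(1, 2 * b - 1)\<close> is \<open>(a - 1, 1)\<close>, which is in the cone precisely because
  \<open>a * b \<le> a + b\<close>.\<close>

lemma split_degree_three:
  fixes a b :: int
  assumes pos: "1 \<le> a" "1 \<le> b" and ne: "\<not> (a = 1 \<and> b = 1)" and small: "a * b \<le> a + b"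
  shows "\<exists>p q. in_interior a b p q 2 \<and> in_cone a b (a - p) (2 * b - q) 1"
proof -
  have "b < a * (2 * b - 1)"
  proof (cases "a = 1")
    case False
    then have "2 * (2 * b - 1) \<le> a * (2 * b - 1)"
      using pos by (intro mult_right_mono) auto
    moreover have "b < 2 * (2 * b - 1)"
      using pos by simp
    ultimately show ?thesis
      by (rule order_less_le_trans[rotated])
  qed (use pos ne in auto)
  then show ?thesis
    using pos small by (intro exI[of _ 1] exI[of _ "2 * b - 1"])
      (auto simp: in_interior_def in_cone_def algebra_simps)
qed

text \<open>An interior point of height at most one would give
  \<open>b \<le> b * x < a * y \<le> a * (b - 1)\<close>, against
  \<open>a * b \<le> a + b\<close>.\<close>

lemma degree_two_empty:
  fixes a b x y t :: int
  assumes "1 \<le> a" "1 \<le> b" "a * b \<le> a + b" "in_interior a b x y t"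
  shows "2 \<le> t"
proof (rule ccontr)
  assume "\<not> 2 \<le> t"
  then have "b * t \<le> b * 1"
    using assms by (intro mult_left_mono) auto
  then have "y \<le> b - 1"
    using assms(4) unfolding in_interior_def by linarith
  then have "a * y \<le> a * (b - 1)"
    using assms by (intro mult_left_mono) auto
  moreover have "b * 1 \<le> b * x"
    using assms by (intro mult_left_mono) (auto simp: in_interior_def)
  moreover have "a * (b - 1) = a * b - a"
    by (simp add: right_diff_distrib)
  ultimately show False
    using assms unfolding in_interior_def by linarith
qed

section \<open>Descent to the minimal height\<close>

text \<open>The bounds in the hypothesis \<open>base\<close> say that the barycentric coordinates \<open>x / a\<close>,
  \<open>y / b - x / a\<close> and \<open>t - y / b\<close>, which belong to the vertices \<open>(a, b)\<close>, \<open>(0, b)\<close> and \<open>(0, 0)\<close>,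
  are at most one.\<close>

lemma interior_split_induct:
  fixes a b d :: int
  assumes pos: "1 \<le> a" "1 \<le> b"
    and low: "\<And>x y t. in_interior a b x y t \<Longrightarrow> d \<le> t"
    and base: "\<And>x y t. in_interior a b x y t \<Longrightarrow> d < t \<Longrightarrow> x \<le> a \<Longrightarrow> a * y - b * x \<le> a * b \<Longrightarrow>
      b * t - y \<le> b \<Longrightarrow> \<exists>p q t'. t' < t \<and> in_interior a b p q t' \<and> in_cone a b (x - p) (y - q) (t - t')"
    and int: "in_interior a b x y t"
  shows "\<exists>p q. in_interior a b p q d \<and> in_cone a b (x - p) (y - q) (t - d)"
  using int
proof (induction "nat (t - d)" arbitrary: x y t rule: less_induct)
  case less
  show ?case
  proof (cases "t = d")
    case True
    then show ?thesis
      using less.prems by (intro exI[of _ x] exI[of _ y]) (auto simp: in_cone_def)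
  next
    case False
    then have "d < t"
      using low[OF less.prems] by simp
    \<comment> \<open>It suffices to split off a cone point of positive height and leave an interior
      point: the latter is split by induction, and cone points add up.\<close>
    have step: ?thesis if t': "t' < t" "in_interior a b x' y' t'"
        "in_cone a b (x - x') (y - y') (t - t')" for x' y' t'
    proof -
      have "nat (t' - d) < nat (t - d)"
        using low[OF t'(2)] t' by simp
      then obtain p q where "in_interior a b p q d" "in_cone a b (x' - p) (y' - q) (t' - d)"
        using less.hyps t'(2) by blast
      then show ?thesis
        using in_cone_add[OF _ t'(3), of "x' - p" "y' - q" "t' - d"] by auto
    qed
    \<comment> \<open>A barycentric coordinate above one stays positive when the corresponding
      vertex, at height one, is subtracted.\<close>
    consider "a < x" | "a * b < a * y - b * x" | "b < b * t - y"
      | "x \<le> a" "a * y - b * x \<le> a * b" "b * t - y \<le> b"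
      by linarith
    then show ?thesis
    proof cases
      case 1
      then show ?thesis
        using less.prems pos by (intro step[of "t - 1" "x - a" "y - b"])
          (auto simp: in_interior_def in_cone_def algebra_simps)
    next
      case 2
      then show ?thesis
        using less.prems pos by (intro step[of "t - 1" x "y - b"])
          (auto simp: in_interior_def in_cone_def algebra_simps)
    next
      case 3
      then show ?thesis
        using less.prems pos by (intro step[of "t - 1" x y])
          (auto simp: in_interior_def in_cone_def algebra_simps)
    next
      case 4
      then show ?thesis
        using base[OF less.prems \<open>d < t\<close>] step by blast
    qed
  qed
qed

text \<open>The sum of the three barycentric coordinates telescopes to \<open>t\<close>; if it is
  \<open>3\<close>, each of them equals one.\<close>

lemma barycentric_height:
  fixes a b x y t :: int
  assumes pos: "1 \<le> a" "1 \<le> b"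
    and "in_interior a b x y t" "x \<le> a" "a * y - b * x \<le> a * b" "b * t - y \<le> b"
  shows "t \<le> 3" "t = 3 \<Longrightarrow> x = a \<and> y = 2 * b"
proof -
  have bx: "b * x \<le> b * a"
    using assms by (intro mult_left_mono) auto
  then have "a * y \<le> 2 * (a * b)"
    using assms(5) by (simp add: mult.commute)
  also have "\<dots> = a * (2 * b)"
    by simp
  finally have y: "y \<le> 2 * b"
    using pos by simp
  then have "b * t \<le> b * 3"
    using assms by linarith
  then show "t \<le> 3"
    using pos by simp
  assume "t = 3"
  then have "y = 2 * b"
    using y assms by simp
  then have "b * a \<le> b * x"
    using assms by (simp add: algebra_simps)
  then have "a \<le> x"
    using pos by simp
  then show "x = a \<and> y = 2 * b"
    using assms \<open>y = 2 * b\<close> by simp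
qed

lemma interior_split:
  fixes a b :: int
  assumes pos: "1 \<le> a" "1 \<le> b"
  shows "\<exists>d. \<forall>x y t. in_interior a b x y t \<longrightarrow>
    (\<exists>p q. in_interior a b p q d \<and> in_cone a b (x - p) (y - q) (t - d))"
proof -
  consider "a + b < a * b" | "a = 1" "b = 1" | "\<not> (a = 1 \<and> b = 1)" "a * b \<le> a + b"
    by linarith
  then show ?thesis
  proof cases
    case 1
    have low: "1 \<le> t" if "in_interior a b x y t" for x y t
    proof -
      have "0 \<le> y"
        using in_cone_bounds(2)[of a b] in_interior_imp_in_cone[OF that] pos by simp
      then have "0 < b * t"
        using that by (simp add: in_interior_def)
      then show ?thesis
        using pos by (simp add: zero_less_mult_iff)
    qed
    have "\<exists>p q. in_interior a b p q 1 \<and> in_cone a b (x - p) (y - q) (t - 1)"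
      if int: "in_interior a b x y t" for x y t
    proof (rule interior_split_induct[OF pos low _ int])
      fix x y t
      assume *: "in_interior a b x y t" "1 < t" "x \<le> a" "a * y - b * x \<le> a * b" "b * t - y \<le> b"
      note t = barycentric_height[OF pos *(1) *(3-5)]
      show "\<exists>p q t'. t' < t \<and> in_interior a b p q t' \<and> in_cone a b (x - p) (y - q) (t - t')"
      proof (cases "t = 3")
        case True
        \<comment> \<open>From \<open>(a, 2 * b, 3)\<close> the point \<open>(1, b - 1, 1)\<close>
          can be removed, leaving \<open>(a - 1, b + 1, 2)\<close> in the cone.\<close>
        then show ?thesis
          using t(2) pos 1 by (intro exI[of _ 1] exI[of _ "b - 1"] exI[of _ 1])
            (auto simp: in_interior_def in_cone_def algebra_simps)
      next
        case False
        then have "t = 2"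
          using * t by linarith
        then show ?thesis
          using split_degree_two[OF pos 1, of x y] * by force
      qed
    qed
    then show ?thesis
      by blast
  next
    case 2
    \<comment> \<open>Interior means \<open>0 < x < y < t\<close>. By integrality these points are
      exactly \<open>(1, 2, 3)\<close> plus cone points.\<close>
    then show ?thesis
      by (intro exI[of _ 3] allI impI exI[of _ 1] exI[of _ 2]) (auto simp: in_interior_def in_cone_def)
  next
    case 3
    have "\<exists>p q. in_interior a b p q 2 \<and> in_cone a b (x - p) (y - q) (t - 2)"
      if int: "in_interior a b x y t" for x y t
    proof (rule interior_split_induct[OF pos degree_two_empty[OF pos 3(2)] _ int])
      fix x y t
      assume *: "in_interior a b x y t" "2 < t" "x \<le> a" "a * y - b * x \<le> a * b" "b * t - y \<le> b"
      note t = barycentric_height[OF pos *(1) *(3-5)]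
      then have "t = 3"
        using * by linarith
      then show "\<exists>p q t'. t' < t \<and> in_interior a b p q t' \<and> in_cone a b (x - p) (y - q) (t - t')"
        using split_degree_three[OF pos 3] t(2) by force
    qed
    then show ?thesis
      by blast
  qed
qed

section \<open>The real polytope and the cone over it\<close>

text \<open>\<open>forall_2\<close> names the indices \<open>1\<close> and \<open>2\<close>; here
  \<open>2\<close> is written as \<open>0\<close>, the first index in the order.\<close>

lemma forall_index_2: "(\<forall>i::2. P i) \<longleftrightarrow> P 0 \<and> P 1"
proof -
  have "(2::2) = 0"
    by simp
  then show ?thesis
    using forall_2[of P] by metis
qed

lemma zero_less_one_index_2: "(0::2) < 1"
  by (simp add: less_bit0_def bit0.Rep_0 bit0.Rep_1)

lemma one_neq_zero_index_2: "(1::2) \<noteq> 0"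
  using zero_less_one_index_2 by simp

lemma lecture_hall_polytope_2:
  fixes s :: "int ^ 2"
  assumes "\<forall>i. 1 \<le> s $ i"
  shows "x \<in> lecture_hall_polytope s \<longleftrightarrow> in_cone (real_of_int (s $ 0)) (of_int (s $ 1)) (x $ 0) (x $ 1) 1"
proof -
  define a b where "a = real_of_int (s $ 0)" and "b = real_of_int (s $ 1)"
  have ab: "0 < a" "0 < b"
    using assms by (simp_all add: a_def b_def int_one_le_iff_zero_less)
  have "x \<in> lecture_hall_polytope s \<longleftrightarrow>
      0 \<le> x $ 0 \<and> 0 \<le> x $ 1 \<and> b * x $ 0 \<le> a * x $ 1 \<and> x $ 0 \<le> a \<and> x $ 1 \<le> b"
    using ab zero_less_one_index_2
    unfolding lecture_hall_polytope_def forall_index_2 a_def[symmetric] b_def[symmetric]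
    by (auto simp: field_simps)
  also have "\<dots> \<longleftrightarrow> in_cone a b (x $ 0) (x $ 1) 1"
    \<comment> \<open>At height one the bounds recover \<open>0 \<le> x $ 1\<close> and
      \<open>x $ 0 \<le> a\<close>.\<close>
    using in_cone_bounds[OF ab, of "x $ 0" "x $ 1" 1] by (auto simp: in_cone_def)
  finally show ?thesis
    by (simp add: a_def b_def)
qed

lemma rel_interior_cone:
  fixes a b :: real
  assumes "0 < a" "0 < b"
  shows "rel_interior {z :: (real ^ 2) \<times> real. in_cone a b (fst z $ 0) (fst z $ 1) (snd z)} =
    {z. in_interior a b (fst z $ 0) (fst z $ 1) (snd z)}"
proof -
  \<comment> \<open>Inner normals of the three facets, so that the cone is an intersection of
    half-spaces.\<close>
  define u v w :: "(real ^ 2) \<times> real" where "u = (axis 0 1, 0)"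
    and "v = (a *\<^sub>R axis 1 1 - b *\<^sub>R axis 0 1, 0)" and "w = (- axis 1 1, b)"
  have inner: "u \<bullet> z = fst z $ 0" "v \<bullet> z = a * fst z $ 1 - b * fst z $ 0" "w \<bullet> z = b * snd z - fst z $ 1"
    for z
    by (simp_all add: u_def v_def w_def inner_prod_def inner_diff_left inner_axis')
  have nz: "u \<noteq> 0" "v \<noteq> 0" "w \<noteq> 0"
    using assms inner(1)[of "(axis 0 1, 0)"] inner(2)[of "(axis 1 1, 0)"] inner(3)[of "(0, 1)"]
    by (auto simp: axis_def)
  have K: "{z :: (real ^ 2) \<times> real. in_cone a b (fst z $ 0) (fst z $ 1) (snd z)} =
      {z. u \<bullet> z \<ge> 0} \<inter> {z. v \<bullet> z \<ge> 0} \<inter> {z. w \<bullet> z \<ge> 0}"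
    unfolding inner in_cone_def by auto
  have int: "interior {z :: (real ^ 2) \<times> real. in_cone a b (fst z $ 0) (fst z $ 1) (snd z)} =
      {z. in_interior a b (fst z $ 0) (fst z $ 1) (snd z)}"
    unfolding K interior_Int interior_halfspace_ge[OF nz(1)] interior_halfspace_ge[OF nz(2)]
      interior_halfspace_ge[OF nz(3)]
    unfolding inner in_interior_def by auto
  \<comment> \<open>The sum of the three vertices at height one. As the interior is nonempty, it
    agrees with the relative interior.\<close>
  have "(\<chi> i::2. if i = 0 then a else 2 * b, 3) \<in> {z. in_interior a b (fst z $ 0) (fst z $ 1) (snd z)}"
    using assms by (simp add: in_interior_def one_neq_zero_index_2)
  then show ?thesis
    using int rel_interior_nonempty_interior by blast
qed

text \<open>The generators lie in the convex cone \<open>?K\<close>. Conversely, Krein-Milman places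
  the polytope in the slice of \<open>?C\<close> at height one without computing vertices; points of
  positive height are scaled to that slice, and at height zero only the origin occurs.\<close>

lemma polytope_cone_lecture_hall_2:
  fixes s :: "int ^ 2"
  assumes s: "\<forall>i. 1 \<le> s $ i"
  defines "a \<equiv> real_of_int (s $ 0)" and "b \<equiv> real_of_int (s $ 1)"
  shows "polytope_cone (lecture_hall_polytope s) =
    {z. in_cone a b (fst z $ 0) (fst z $ 1) (snd z)}" (is "?C = ?K")
proof -
  define P where "P = lecture_hall_polytope s"
  have ab: "0 < a" "0 < b"
    using s by (simp_all add: a_def b_def int_one_le_iff_zero_less)
  have P: "x \<in> P \<longleftrightarrow> in_cone a b (x $ 0) (x $ 1) 1" for x
    unfolding P_def a_def b_def by (rule lecture_hall_polytope_2[OF s])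
  have scale: "in_cone a b (c * x) (c * y) (c * t)" if "in_cone a b x y t" "0 \<le> c" for c x y t
    using that mult_left_mono[of "b * x" "a * y" c] mult_left_mono[of y "b * t" c]
    by (auto simp: in_cone_def mult.left_commute)
  have "convex_cone ?K"
    unfolding convex_cone_iff using ab
    by (auto intro: in_cone_add scale) (auto simp: in_cone_def)
  moreover have "(\<lambda>v. (v, 1)) ` {v. v extreme_point_of P} \<subseteq> ?K"
    by (auto simp: extreme_point_of_def P)
  ultimately have "?C \<subseteq> ?K"
    unfolding polytope_cone_def P_def[symmetric] by (simp add: hull_minimal)
  moreover have "z \<in> ?C" if "z \<in> ?K" for z
  proof -
    have cone: "convex_cone ?C"
      unfolding polytope_cone_def by (rule convex_cone_convex_cone_hull)
    have "convex P"
      unfolding convex_def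
    proof (intro ballI allI impI)
      fix x y and u v :: real
      assume "x \<in> P" "y \<in> P" "0 \<le> u" "0 \<le> v" "u + v = 1"
      then show "u *\<^sub>R x + v *\<^sub>R y \<in> P"
        using in_cone_add[OF scale[of "x $ 0" "x $ 1" 1 u] scale[of "y $ 0" "y $ 1" 1 v]]
        by (simp add: P)
    qed
    moreover have "compact P"
    proof -
      have P_eq: "P = {x. 0 \<le> x $ 0 \<and> b * x $ 0 \<le> a * x $ 1 \<and> x $ 1 \<le> b * 1}"
        using P by (auto simp: in_cone_def)
      have "closed P"
        unfolding P_eq by (intro closed_Collect_conj closed_Collect_le continuous_intros)
      moreover have "P \<subseteq> cbox 0 (\<chi> i. if i = 0 then a else b)"
      proof
        fix x assume "x \<in> P"
        then show "x \<in> cbox 0 (\<chi> i. if i = 0 then a else b)"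
          using in_cone_bounds[OF ab, of "x $ 0" "x $ 1" 1]
          by (auto simp: P mem_box_cart forall_index_2 one_neq_zero_index_2)
      qed
      then have "bounded P"
        using bounded_cbox bounded_subset by blast
      ultimately show ?thesis
        by (simp add: compact_eq_bounded_closed)
    qed
    ultimately have P_hull: "P = convex hull {v. v extreme_point_of P}"
      by (intro Krein_Milman_Minkowski)
    have "convex ?C"
      using cone by (simp add: convex_cone_def)
    then have "convex {v. (v, 1) \<in> ?C}"
      unfolding convex_def by force
    moreover have "{v. v extreme_point_of P} \<subseteq> {v. (v, 1) \<in> ?C}"
      unfolding polytope_cone_def P_def by (auto intro: hull_inc)
    ultimately have P_sub: "P \<subseteq> {v. (v, 1) \<in> ?C}"
      using P_hull by (metis hull_minimal)
    show ?thesis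
    proof (cases "snd z = 0")
      case True
      have "fst z $ 0 = 0 \<and> fst z $ 1 = 0"
        using in_cone_bounds[OF ab, of "fst z $ 0" "fst z $ 1" 0] that True by simp
      then have "z = 0"
        using True by (simp add: prod_eq_iff vec_eq_iff forall_index_2)
      then show ?thesis
        using cone by (simp add: convex_cone_contains_0)
    next
      case False
      then have "0 < snd z"
        using in_cone_bounds(3)[OF ab] that by force
      then have "in_cone a b (fst z $ 0 / snd z) (fst z $ 1 / snd z) 1"
        using scale[of _ _ _ "1 / snd z"] that by force
      then have "(fst z /\<^sub>R snd z, 1) \<in> ?C"
        using P_sub P[of "fst z /\<^sub>R snd z"] by (auto simp: divide_inverse mult.commute)
      then have "snd z *\<^sub>R (fst z /\<^sub>R snd z, 1) \<in> ?C"
        using \<open>0 < snd z\<close> unfolding polytope_cone_def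
        by (intro convex_cone_hull_mul) simp_all
      then show ?thesis
        using \<open>0 < snd z\<close> by simp
    qed
  qed
  ultimately show ?thesis
    by blast
qed

section \<open>Levelness through lattice points\<close>

theorem corollary22:
  fixes s :: "int ^ 2"
  assumes "\<forall>i. 1 \<le> s $ i"
  shows "level_polytope TYPE('k::{alg_closed_field, field_char_0}) (lecture_hall_polytope s)"
proof -
  define a b where "a = s $ 0" and "b = s $ 1"
  have pos: "1 \<le> a" "1 \<le> b"
    using assms by (simp_all add: a_def b_def)
  define S I where "S = {z :: 2 lattice. in_cone a b (fst z $ 0) (fst z $ 1) (snd z)}"
    and "I = {z :: 2 lattice. in_interior a b (fst z $ 0) (fst z $ 1) (snd z)}"
  have S: "lattice_points (polytope_cone (lecture_hall_polytope s)) = S"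
    unfolding polytope_cone_lecture_hall_2[OF assms] lattice_points_def lattice_embed_def S_def
      in_cone_def a_def b_def by (simp flip: of_int_mult)
  have I: "lattice_points (rel_interior (polytope_cone (lecture_hall_polytope s))) = I"
    using pos unfolding polytope_cone_lecture_hall_2[OF assms] a_def b_def
    by (subst rel_interior_cone)
      (auto simp: lattice_points_def lattice_embed_def I_def in_interior_def a_def b_def simp flip: of_int_mult)
  obtain d where d: "\<And>x y t. in_interior a b x y t \<Longrightarrow>
      \<exists>p q. in_interior a b p q d \<and> in_cone a b (x - p) (y - q) (t - d)"
    using interior_split[OF pos] by blast
  \<comment> \<open>All interior lattice points of height \<open>d\<close> serve as generators; they
    lie in the box \<open>{0..a * d} \<times> {0..b * d}\<close>.\<close>
  define C where "C = {z \<in> I. snd z = d}"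
  have "C \<subseteq> (\<lambda>(p, q). (\<chi> i. if i = 0 then p else q, d)) ` ({0..a * d} \<times> {0..b * d})"
  proof
    fix c assume "c \<in> C"
    then have "in_cone a b (fst c $ 0) (fst c $ 1) d" "snd c = d"
      by (auto simp: C_def I_def in_interior_imp_in_cone)
    then show "c \<in> (\<lambda>(p, q). (\<chi> i. if i = 0 then p else q, d)) ` ({0..a * d} \<times> {0..b * d})"
      using in_cone_bounds[of a b "fst c $ 0" "fst c $ 1" d] pos
      by (intro image_eqI[of _ _ "(fst c $ 0, fst c $ 1)"])
        (auto simp: prod_eq_iff vec_eq_iff forall_index_2 one_neq_zero_index_2)
  qed
  then have "finite C"
    by (rule finite_subset) simp
  moreover have "(\<Union>c\<in>C. (\<lambda>z. c + z) ` S) = I"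
  proof (intro equalityI subsetI)
    fix z assume "z \<in> (\<Union>c\<in>C. (\<lambda>z. c + z) ` S)"
    then show "z \<in> I"
      by (auto simp: C_def I_def S_def intro: in_interior_add)
  next
    fix z assume "z \<in> I"
    then obtain p q where pq: "in_interior a b p q d"
        "in_cone a b (fst z $ 0 - p) (fst z $ 1 - q) (snd z - d)"
      using d unfolding I_def by blast
    define c :: "2 lattice" where "c = (\<chi> i. if i = 0 then p else q, d)"
    have "c \<in> C" "z - c \<in> S"
      using pq by (simp_all add: C_def I_def S_def c_def)
    then show "z \<in> (\<Union>c\<in>C. (\<lambda>z. c + z) ` S)"
      by (intro UN_I[of c] image_eqI[of _ _ "z - c"]) auto
  qed
  ultimately show ?thesis
    unfolding level_polytope_iff S I
    by (intro exI[of _ d] exI[of _ C]) (auto simp: C_def)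
qed

end
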